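(* Let $\eta_1>0,\ \rho_1\ne0,\ \mathcal{C}_1$ and $\eta_2>0,\ \rho_2\neq0,\ \mathcal{C}_2$ be real parameters with $\eta_1\neq\eta_2$ and $$\frac{\mathcal{C}_1}{\eta_1\rho_1}=\frac{\mathcal{C}_2}{\eta_2\rho_2}.$$ For $i=1,2$ let $(w_i,y_i)$ be the one-soliton pair with parameters $\eta_i,\rho_i,\mathcal{C}_i$ and any phase constant $\beta_i\in\mathbb{R}$. Then the solution of the coupled KdV system with $\lambda=-1$ obtained from the permutability formulas, $$w_{12}=\frac{24(\eta_1-\eta_2)(w_1-w_2)}{(w_1-w_2)^2+(y_1-y_2)^2},\qquad y_{12}=\frac{-24(\eta_1-\eta_2)(y_1-y_2)}{(w_1-w_2)^2+(y_1-y_2)^2},$$ is regular; that is, the denominator vanishes nowhere on $\mathbb{R}^2$, and $w_{12},y_{12}$ (hence $u=(w_{12})_x$, $v=(y_{12})_x$) are $C^\infty$ on all of $\mathbb{R}^2$ and solve the system.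
   Context: The coupled KdV system with $\lambda=-1$ is $u_t+uu_x+u_{xxx}-vv_x=0$, $v_t+u_xv+v_xu+v_{xxx}=0$; in terms of potentials $u=w_x$, $v=y_x$ it is $w_t+\frac12w_x^2+w_{xxx}-\frac12y_x^2=0$, $y_t+w_xy_x+y_{xxx}=0$. The one-soliton pair with real parameters $\eta>0$, $\rho\neq0$, $\mathcal{C}$ and phase constant $\beta$ is $$w=12\sqrt{\tfrac{\eta}{6}}\;\frac{\sinh(ax+b)}{\cosh(ax+b)-\frac{3\mathcal{C}}{\eta A}},\qquad y=\frac{\rho}{A}\,\frac{1}{\cosh(ax+b)-\frac{3\mathcal{C}}{\eta A}},$$ $$A=\left[\left(\tfrac{3\mathcal{C}}{\eta}\right)^2+\tfrac6\eta\left(\tfrac{\rho}{12}\right)^2\right]^{1/2},\qquad a=2\sqrt{\tfrac\eta6},\qquad b=-a^3t+\beta .$$ It is a transform of the trivial solution $(w_0,y_0)=(0,0)$ under the Bäcklund transformation with parameter $\eta$, so the permutability formulas are applied with $(w_0,y_0)=(0,0)$. *)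

theory Defs
  imports "HOL-Analysis.Analysis"
begin

text \<open>Scalar fields on the plane are curried functions of space \<open>x\<close> and time \<open>t\<close>, in this order.\<close>

type_synonym field2 = "real \<Rightarrow> real \<Rightarrow> real"

text \<open>The library has no notion of \<open>C\<^sup>k\<close> map for several variables. On an open subset of a
  finite-dimensional space the following is the usual one: all directional derivatives up to
  order \<open>k\<close> exist and are continuous.\<close>

primrec Ck_on :: "nat \<Rightarrow> 'a::real_normed_vector set \<Rightarrow> ('a \<Rightarrow> 'b::real_normed_vector) \<Rightarrow> bool" where
  "Ck_on 0 S f \<longleftrightarrow> continuous_on S f"
| "Ck_on (Suc k) S f \<longleftrightarrow>
     (\<forall>p\<in>S. f differentiable (at p)) \<and>
     (\<forall>d. Ck_on k S (\<lambda>p. frechet_derivative f (at p) d))"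

definition smooth_field :: "field2 \<Rightarrow> bool" where
  "smooth_field f \<longleftrightarrow> (\<forall>k. Ck_on k UNIV (\<lambda>(x, t). f x t))"

definition Dx :: "field2 \<Rightarrow> field2" where
  "Dx f = (\<lambda>x t. deriv (\<lambda>s. f s t) x)"

definition Dt :: "field2 \<Rightarrow> field2" where
  "Dt f = (\<lambda>x t. deriv (\<lambda>s. f x s) t)"

text \<open>The coupled KdV system with \<open>\<lambda> = -1\<close> and its potential form. As \<^const>\<open>deriv\<close> is total,
  these predicates express the equations in the classical sense only for sufficiently
  differentiable fields; they are to be combined with \<^const>\<open>smooth_field\<close>.\<close>

definition coupled_kdv :: "field2 \<Rightarrow> field2 \<Rightarrow> bool" where
  "coupled_kdv u v \<longleftrightarrow> (\<forall>x t.
     Dt u x t + u x t * Dx u x t + Dx (Dx (Dx u)) x t - v x t * Dx v x t = 0 \<and>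
     Dt v x t + Dx u x t * v x t + Dx v x t * u x t + Dx (Dx (Dx v)) x t = 0)"

definition potential_coupled_kdv :: "field2 \<Rightarrow> field2 \<Rightarrow> bool" where
  "potential_coupled_kdv w y \<longleftrightarrow> (\<forall>x t.
     Dt w x t + 1/2 * (Dx w x t)\<^sup>2 + Dx (Dx (Dx w)) x t - 1/2 * (Dx y x t)\<^sup>2 = 0 \<and>
     Dt y x t + Dx w x t * Dx y x t + Dx (Dx (Dx y)) x t = 0)"

definition soliton_A :: "real \<Rightarrow> real \<Rightarrow> real \<Rightarrow> real" where
  "soliton_A \<eta> \<rho> C = sqrt ((3 * C / \<eta>)\<^sup>2 + 6 / \<eta> * (\<rho> / 12)\<^sup>2)"

definition soliton_a :: "real \<Rightarrow> real" where
  "soliton_a \<eta> = 2 * sqrt (\<eta> / 6)"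

definition soliton_phase :: "real \<Rightarrow> real \<Rightarrow> field2" where
  "soliton_phase \<eta> \<beta> x t = soliton_a \<eta> * x + (- (soliton_a \<eta> ^ 3) * t + \<beta>)"

definition soliton_w :: "real \<Rightarrow> real \<Rightarrow> real \<Rightarrow> real \<Rightarrow> field2" where
  "soliton_w \<eta> \<rho> C \<beta> x t =
     12 * sqrt (\<eta> / 6) *
     (sinh (soliton_phase \<eta> \<beta> x t) /
      (cosh (soliton_phase \<eta> \<beta> x t) - 3 * C / (\<eta> * soliton_A \<eta> \<rho> C)))"

definition soliton_y :: "real \<Rightarrow> real \<Rightarrow> real \<Rightarrow> real \<Rightarrow> field2" where
  "soliton_y \<eta> \<rho> C \<beta> x t =
     \<rho> / soliton_A \<eta> \<rho> C *
     (1 / (cosh (soliton_phase \<eta> \<beta> x t) - 3 * C / (\<eta> * soliton_A \<eta> \<rho> C)))"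

text \<open>The permutability formulas over the trivial seed \<open>(w\<^sub>0, y\<^sub>0) = (0, 0)\<close>.\<close>

definition perm_denom :: "field2 \<Rightarrow> field2 \<Rightarrow> field2 \<Rightarrow> field2 \<Rightarrow> field2" where
  "perm_denom w1 y1 w2 y2 x t = (w1 x t - w2 x t)\<^sup>2 + (y1 x t - y2 x t)\<^sup>2"

definition perm_w :: "real \<Rightarrow> real \<Rightarrow> field2 \<Rightarrow> field2 \<Rightarrow> field2 \<Rightarrow> field2 \<Rightarrow> field2" where
  "perm_w \<eta>1 \<eta>2 w1 y1 w2 y2 x t =
     24 * (\<eta>1 - \<eta>2) * (w1 x t - w2 x t) / perm_denom w1 y1 w2 y2 x t"

definition perm_y :: "real \<Rightarrow> real \<Rightarrow> field2 \<Rightarrow> field2 \<Rightarrow> field2 \<Rightarrow> field2 \<Rightarrow> field2" where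
  "perm_y \<eta>1 \<eta>2 w1 y1 w2 y2 x t =
     - 24 * (\<eta>1 - \<eta>2) * (y1 x t - y2 x t) / perm_denom w1 y1 w2 y2 x t"

end

theory Submission imports Defs begin

text \<open>With \<open>W = w + \<i> y\<close> the potential system with \<open>\<lambda> = -1\<close> is the single complex
  equation \<open>W\<^sub>t + W\<^sub>x\<^sup>2 / 2 + W\<^sub>x\<^sub>x\<^sub>x = 0\<close>, and the permutability formulas
  become \<open>Z = 24 (\<eta>\<^sub>1 - \<eta>\<^sub>2) / (W\<^sub>1 - W\<^sub>2)\<close>. Each one-soliton pair satisfies
  \<open>W\<^sub>x = 2 \<eta> - W\<^sup>2 / 12\<close> and \<open>W\<^sub>t = - (2 \<eta> / 3) W\<^sub>x\<close>. Hence the algebra generated by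
  \<open>W\<^sub>1\<close>, \<open>W\<^sub>2\<close> and \<open>1 / (W\<^sub>1 - W\<^sub>2)\<close> is closed under partial derivatives, which gives smoothness,
  and the equations for \<open>Z\<close> are polynomial identities modulo \<open>Z (W\<^sub>1 - W\<^sub>2) = 24 (\<eta>\<^sub>1 - \<eta>\<^sub>2)\<close>.

  For regularity, put \<open>c = 3 C / (\<eta> A)\<close> and \<open>S = \<rho> / (6 a A)\<close>, so that \<open>c\<^sup>2 + S\<^sup>2 = 1\<close> and the
  hypothesis says that \<open>\<kappa> = c / (a S)\<close> is the same for both solitons. If \<open>W\<^sub>1 = W\<^sub>2\<close> at some
  point, then \<open>m = sinh \<theta> / S\<close> and \<open>n = cosh \<theta> / (a S)\<close> also agree there, and
  \<open>(n\<^sup>2 - \<kappa>\<^sup>2) a\<^sup>2 = 1 + m\<^sup>2\<close> for two different values of \<open>a\<^sup>2\<close>, which is absurd.\<close>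

section \<open>Partial derivatives\<close>

text \<open>Total differentiability is required, not just existence of the partials, because
  \<open>Ck_on\<close> speaks of \<open>frechet_derivative\<close>. Naming both partials lets them
  be computed by closure rules.\<close>

definition has_partials ::
    "(real \<times> real \<Rightarrow> 'b::real_normed_vector) \<Rightarrow> (real \<times> real \<Rightarrow> 'b) \<Rightarrow> (real \<times> real \<Rightarrow> 'b) \<Rightarrow> bool" where
  "has_partials F X T \<longleftrightarrow>
     (\<forall>p. (F has_derivative (\<lambda>d. fst d *\<^sub>R X p + snd d *\<^sub>R T p)) (at p))"

lemma has_partialsD:
  "has_partials F X T \<Longrightarrow> (F has_derivative (\<lambda>d. fst d *\<^sub>R X p + snd d *\<^sub>R T p)) (at p)"
  unfolding has_partials_def by blast

lemma has_partials_cong: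
  assumes "has_partials F X T" "\<And>p. X p = X' p" "\<And>p. T p = T' p"
  shows "has_partials F X' T'"
  using assms by (simp add: has_partials_def)

lemma has_partials_const: "has_partials (\<lambda>_. c) (\<lambda>_. 0) (\<lambda>_. 0)"
  by (simp add: has_partials_def)

lemma has_partials_add:
  assumes "has_partials F X T" "has_partials G Y U"
  shows "has_partials (\<lambda>p. F p + G p) (\<lambda>p. X p + Y p) (\<lambda>p. T p + U p)"
  unfolding has_partials_def
proof
  fix p
  show "((\<lambda>p. F p + G p) has_derivative
      (\<lambda>d. fst d *\<^sub>R (X p + Y p) + snd d *\<^sub>R (T p + U p))) (at p)"
    using has_derivative_add[OF assms[THEN has_partialsD], of p] by (simp add: algebra_simps)
qed

lemma has_partials_mult:
  fixes F G :: "real \<times> real \<Rightarrow> 'b::real_normed_algebra"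
  assumes "has_partials F X T" "has_partials G Y U"
  shows "has_partials (\<lambda>p. F p * G p)
           (\<lambda>p. X p * G p + F p * Y p) (\<lambda>p. T p * G p + F p * U p)"
  unfolding has_partials_def
proof
  fix p
  have "((\<lambda>p. F p * G p) has_derivative
      (\<lambda>d. F p * (fst d *\<^sub>R Y p + snd d *\<^sub>R U p) + (fst d *\<^sub>R X p + snd d *\<^sub>R T p) * G p)) (at p)"
    by (rule has_derivative_mult[OF assms[THEN has_partialsD]])
  then show "((\<lambda>p. F p * G p) has_derivative
      (\<lambda>d. fst d *\<^sub>R (X p * G p + F p * Y p) + snd d *\<^sub>R (T p * G p + F p * U p))) (at p)"
    by (simp add: algebra_simps)
qed

lemma has_partials_cmult:
  fixes F :: "real \<times> real \<Rightarrow> 'b::real_normed_algebra"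
  assumes "has_partials F X T"
  shows "has_partials (\<lambda>p. c * F p) (\<lambda>p. c * X p) (\<lambda>p. c * T p)"
  using has_partials_mult[OF has_partials_const assms, of c] by simp

lemma has_partials_diff:
  fixes F G :: "real \<times> real \<Rightarrow> 'b::real_normed_algebra_1"
  assumes "has_partials F X T" "has_partials G Y U"
  shows "has_partials (\<lambda>p. F p - G p) (\<lambda>p. X p - Y p) (\<lambda>p. T p - U p)"
  using has_partials_add[OF assms(1) has_partials_cmult[OF assms(2), of "-1"]] by simp

lemma has_partials_inverse:
  fixes F :: "real \<times> real \<Rightarrow> 'b::real_normed_field"
  assumes "has_partials F X T" "\<And>p. F p \<noteq> 0"
  shows "has_partials (\<lambda>p. inverse (F p))
           (\<lambda>p. - (inverse (F p) * X p * inverse (F p)))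
           (\<lambda>p. - (inverse (F p) * T p * inverse (F p)))"
  unfolding has_partials_def
proof
  fix p
  have "((\<lambda>p. inverse (F p)) has_derivative
      (\<lambda>d. - (inverse (F p) * (fst d *\<^sub>R X p + snd d *\<^sub>R T p) * inverse (F p)))) (at p)"
    by (rule Deriv.has_derivative_inverse[OF assms(2) has_partialsD[OF assms(1)]])
  then show "((\<lambda>p. inverse (F p)) has_derivative
      (\<lambda>d. fst d *\<^sub>R - (inverse (F p) * X p * inverse (F p))
         + snd d *\<^sub>R - (inverse (F p) * T p * inverse (F p)))) (at p)"
    by (simp add: algebra_simps)
qed

lemma has_partials_bounded_linear:
  assumes "bounded_linear L" "has_partials F X T"
  shows "has_partials (\<lambda>p. L (F p)) (\<lambda>p. L (X p)) (\<lambda>p. L (T p))"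
  unfolding has_partials_def
proof
  fix p
  interpret bounded_linear L by fact
  have "((\<lambda>p. L (F p)) has_derivative (\<lambda>d. L (fst d *\<^sub>R X p + snd d *\<^sub>R T p))) (at p)"
    by (rule bounded_linear.has_derivative[OF assms(1) has_partialsD[OF assms(2)]])
  then show "((\<lambda>p. L (F p)) has_derivative (\<lambda>d. fst d *\<^sub>R L (X p) + snd d *\<^sub>R L (T p))) (at p)"
    by (simp add: add scaleR)
qed

text \<open>Composing with the line \<open>s \<mapsto> (s, t)\<close> turns the total derivative
  into the one-variable derivative behind \<open>deriv\<close>.\<close>

lemma Dx_has_partials:
  assumes "has_partials (\<lambda>p. f (fst p) (snd p)) (\<lambda>p. X (fst p) (snd p)) T"
  shows "Dx f = X"
proof (intro ext)
  fix x t :: real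
  have 1: "((\<lambda>s. (s, t)) has_derivative (\<lambda>h. (h, 0))) (at x)"
    by (auto intro!: derivative_eq_intros)
  have 2: "((\<lambda>p. f (fst p) (snd p)) has_derivative
      (\<lambda>d. fst d *\<^sub>R X x t + snd d *\<^sub>R T (x, t))) (at (x, t))"
    using assms by (auto simp: has_partials_def)
  have "((\<lambda>s. f s t) has_derivative (\<lambda>h. h *\<^sub>R X x t)) (at x)"
    using has_derivative_compose[OF 1 2] by simp
  then have "((\<lambda>s. f s t) has_field_derivative X x t) (at x)"
    by (simp only: has_real_derivative_iff_has_vector_derivative has_vector_derivative_def)
  then show "Dx f x t = X x t"
    by (simp add: Dx_def DERIV_imp_deriv)
qed

lemma Dt_has_partials:
  assumes "has_partials (\<lambda>p. f (fst p) (snd p)) X (\<lambda>p. T (fst p) (snd p))"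
  shows "Dt f = T"
proof (intro ext)
  fix x t :: real
  have 1: "((\<lambda>s. (x, s)) has_derivative (\<lambda>h. (0, h))) (at t)"
    by (auto intro!: derivative_eq_intros)
  have 2: "((\<lambda>p. f (fst p) (snd p)) has_derivative
      (\<lambda>d. fst d *\<^sub>R X (x, t) + snd d *\<^sub>R T x t)) (at (x, t))"
    using assms by (auto simp: has_partials_def)
  have "((\<lambda>s. f x s) has_derivative (\<lambda>h. h *\<^sub>R T x t)) (at t)"
    using has_derivative_compose[OF 1 2] by simp
  then have "((\<lambda>s. f x s) has_field_derivative T x t) (at t)"
    by (simp only: has_real_derivative_iff_has_vector_derivative has_vector_derivative_def)
  then show "Dt f x t = T x t"
    by (simp add: Dt_def DERIV_imp_deriv)
qed

section \<open>Smoothness\<close>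

inductive_set gen_algebra :: "('a \<Rightarrow> 'b::comm_ring_1) set \<Rightarrow> ('a \<Rightarrow> 'b) set"
  for G :: "('a \<Rightarrow> 'b) set" where
  const: "(\<lambda>_. c) \<in> gen_algebra G"
| gen: "g \<in> G \<Longrightarrow> g \<in> gen_algebra G"
| add: "f \<in> gen_algebra G \<Longrightarrow> g \<in> gen_algebra G \<Longrightarrow> (\<lambda>p. f p + g p) \<in> gen_algebra G"
| mult: "f \<in> gen_algebra G \<Longrightarrow> g \<in> gen_algebra G \<Longrightarrow> (\<lambda>p. f p * g p) \<in> gen_algebra G"

lemma gen_algebra_minus:
  assumes "f \<in> gen_algebra G"
  shows "(\<lambda>p. - f p) \<in> gen_algebra G"
  using gen_algebra.mult[OF gen_algebra.const[of "-1"] assms] by simp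

lemma gen_algebra_diff:
  assumes "f \<in> gen_algebra G" "g \<in> gen_algebra G"
  shows "(\<lambda>p. f p - g p) \<in> gen_algebra G"
  using gen_algebra.add[OF assms(1) gen_algebra_minus[OF assms(2)]] by simp

text \<open>By the sum and product rules, closure of the algebra under both partials need only be
  checked on generators.\<close>

lemma gen_algebra_has_partials:
  fixes G :: "(real \<times> real \<Rightarrow> 'b::real_normed_field) set"
  assumes G: "\<And>g. g \<in> G \<Longrightarrow> \<exists>X\<in>gen_algebra G. \<exists>T\<in>gen_algebra G. has_partials g X T"
    and "f \<in> gen_algebra G"
  shows "\<exists>X\<in>gen_algebra G. \<exists>T\<in>gen_algebra G. has_partials f X T"
  using assms(2)
proof induction
  case (const c)
  then show ?case using has_partials_const gen_algebra.const by blast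
next
  case (gen g)
  then show ?case using G by blast
next
  case (add f g)
  then obtain X T Y U where
    XT: "X \<in> gen_algebra G" "T \<in> gen_algebra G" "Y \<in> gen_algebra G" "U \<in> gen_algebra G"
    and "has_partials f X T" "has_partials g Y U" by blast
  then have "has_partials (\<lambda>p. f p + g p) (\<lambda>p. X p + Y p) (\<lambda>p. T p + U p)"
    by (intro has_partials_add)
  moreover have "(\<lambda>p. X p + Y p) \<in> gen_algebra G" "(\<lambda>p. T p + U p) \<in> gen_algebra G"
    by (intro gen_algebra.add XT)+
  ultimately show ?case by blast
next
  case (mult f g)
  then obtain X T Y U where
    XT: "X \<in> gen_algebra G" "T \<in> gen_algebra G" "Y \<in> gen_algebra G" "U \<in> gen_algebra G"
    and "has_partials f X T" "has_partials g Y U" by blast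
  then have "has_partials (\<lambda>p. f p * g p) (\<lambda>p. X p * g p + f p * Y p) (\<lambda>p. T p * g p + f p * U p)"
    by (intro has_partials_mult)
  moreover have "(\<lambda>p. X p * g p + f p * Y p) \<in> gen_algebra G"
    "(\<lambda>p. T p * g p + f p * U p) \<in> gen_algebra G"
    by (intro gen_algebra.add gen_algebra.mult XT mult.hyps)+
  ultimately show ?case by blast
qed

text \<open>A directional derivative is a combination of the two partials with constant
  coefficients, hence again in the algebra, and induction on \<open>k\<close> applies.\<close>

lemma gen_algebra_Ck:
  fixes G :: "(real \<times> real \<Rightarrow> 'b::real_normed_field) set"
  assumes G: "\<And>g. g \<in> G \<Longrightarrow> \<exists>X\<in>gen_algebra G. \<exists>T\<in>gen_algebra G. has_partials g X T"
    and "f \<in> gen_algebra G"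
  shows "Ck_on k UNIV f"
  using assms(2)
proof (induction k arbitrary: f)
  case 0
  then obtain X T where "has_partials f X T"
    using gen_algebra_has_partials[OF G] by blast
  then show ?case
    by (auto simp: has_partials_def intro!: continuous_at_imp_continuous_on has_derivative_continuous)
next
  case (Suc k)
  then obtain X T where XT: "X \<in> gen_algebra G" "T \<in> gen_algebra G" "has_partials f X T"
    using gen_algebra_has_partials[OF G] by blast
  have D: "(f has_derivative (\<lambda>d. fst d *\<^sub>R X p + snd d *\<^sub>R T p)) (at p)" for p
    using XT(3) by (rule has_partialsD)
  have fr: "frechet_derivative f (at p) d = of_real (fst d) * X p + of_real (snd d) * T p" for p d
    unfolding frechet_derivative_at[OF D, symmetric] by (simp only: scaleR_conv_of_real)
  have "Ck_on k UNIV (\<lambda>p. of_real (fst d) * X p + of_real (snd d) * T p)" for d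
    by (intro Suc.IH gen_algebra.add gen_algebra.mult gen_algebra.const XT)
  moreover have "f differentiable (at p)" for p
    by (rule differentiableI[OF D])
  ultimately show ?case
    unfolding Ck_on.simps fr by blast
qed

text \<open>A bounded linear map commutes with differentiation. This carries smoothness from a
  complex function to its real and imaginary parts.\<close>

lemma Ck_on_UNIV_bounded_linear:
  assumes "bounded_linear L" "Ck_on k UNIV f"
  shows "Ck_on k UNIV (\<lambda>p. L (f p))"
  using assms(2)
proof (induction k arbitrary: f)
  case 0
  then show ?case
    using bounded_linear.continuous_on[OF assms(1)] by auto
next
  case (Suc k)
  have D: "((\<lambda>p. L (f p)) has_derivative (\<lambda>d. L (frechet_derivative f (at p) d))) (at p)" for p
    using Suc.prems
    by (intro bounded_linear.has_derivative[OF assms(1)]) (auto simp: frechet_derivative_works[symmetric])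
  have "(\<lambda>p. L (f p)) differentiable (at p)" for p
    by (rule differentiableI[OF D])
  moreover have "Ck_on k UNIV (\<lambda>p. L (frechet_derivative f (at p) d))" for d
    using Suc.prems by (intro Suc.IH) simp
  ultimately show ?case
    unfolding Ck_on.simps frechet_derivative_at[OF D, symmetric] by blast
qed


section \<open>One-soliton pairs\<close>

lemma cosh_minus_pos:
  fixes c S :: real
  assumes "c\<^sup>2 + S\<^sup>2 = 1" "S \<noteq> 0"
  shows "cosh (\<theta>::real) - c > 0"
proof -
  have "c\<^sup>2 < 1" using assms by (metis less_add_same_cancel1 zero_less_power2)
  then have "c < 1" by (simp add: abs_square_less_1)
  then show ?thesis using cosh_real_ge_1[of \<theta>] by linarith
qed

text \<open>Writing \<open>c = cos \<phi>\<close> and \<open>S = sin \<phi>\<close>,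
  \<open>T \<theta>\<close> is \<open>coth ((\<theta> - \<i> \<phi>) / 2)\<close>, that is, tanh of
  half the argument with an imaginary shift, which explains the Riccati equation.\<close>

lemma riccati_tanh_shifted:
  fixes c S :: real
  assumes "c\<^sup>2 + S\<^sup>2 = 1" "S \<noteq> 0"
  defines "T \<equiv> \<lambda>\<theta>. Complex (sinh \<theta> / (cosh \<theta> - c)) (S / (cosh \<theta> - c))"
  shows "(T has_vector_derivative (1 - (T \<theta>)\<^sup>2) / 2) (at \<theta>)"
proof -
  have d: "cosh \<theta> - c \<noteq> 0"
    using cosh_minus_pos[OF assms(1,2), of \<theta>] by simp
  have sc: "sinh \<theta> ^ 2 = cosh \<theta> ^ 2 - 1" "S\<^sup>2 = 1 - c\<^sup>2"
    using assms(1) by (simp_all add: sinh_square_eq)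
  let ?d = "cosh \<theta> - c"
  have w: "((\<lambda>\<theta>. sinh \<theta> / (cosh \<theta> - c)) has_real_derivative (1 - c * cosh \<theta>) / ?d\<^sup>2) (at \<theta>)"
  proof -
    have "((\<lambda>\<theta>. sinh \<theta> / (cosh \<theta> - c)) has_real_derivative
        (cosh \<theta> * ?d - sinh \<theta> * sinh \<theta>) / (?d * ?d)) (at \<theta>)"
      using d by (auto intro!: derivative_eq_intros)
    moreover have "cosh \<theta> * ?d - sinh \<theta> * sinh \<theta> = 1 - c * cosh \<theta>"
      using sc(1) by (simp add: power2_eq_square algebra_simps)
    ultimately show ?thesis by (simp add: power2_eq_square)
  qed
  have y: "((\<lambda>\<theta>. S / (cosh \<theta> - c)) has_real_derivative - S * sinh \<theta> / ?d\<^sup>2) (at \<theta>)"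
    using d by (auto intro!: derivative_eq_intros simp: power2_eq_square)
  have "(T has_vector_derivative Complex ((1 - c * cosh \<theta>) / ?d\<^sup>2) (- S * sinh \<theta> / ?d\<^sup>2)) (at \<theta>)"
    unfolding T_def Complex_eq using w y
    by (intro derivative_intros has_vector_derivative_of_real has_vector_derivative_mult_right)
  moreover have "Complex ((1 - c * cosh \<theta>) / ?d\<^sup>2) (- S * sinh \<theta> / ?d\<^sup>2) = (1 - (T \<theta>)\<^sup>2) / 2"
  proof (rule complex_eqI)
    \<comment> \<open>The right side is half the numerator of the real part of
      \<open>1 - (T \<theta>)\<^sup>2\<close> over the denominator
      \<open>?d\<^sup>2\<close>.\<close>
    have "1 - c * cosh \<theta> = (?d\<^sup>2 - sinh \<theta> ^ 2 + S\<^sup>2) / 2"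
      unfolding sc by (simp add: power2_eq_square algebra_simps)
    with d show "Re (Complex ((1 - c * cosh \<theta>) / ?d\<^sup>2) (- S * sinh \<theta> / ?d\<^sup>2)) = Re ((1 - (T \<theta>)\<^sup>2) / 2)"
      by (simp add: T_def Re_power2 power_divide diff_divide_distrib add_divide_distrib)
  qed (simp add: T_def power2_eq_square)
  ultimately show ?thesis by (simp only:)
qed

locale soliton =
  fixes \<eta> \<rho> C \<beta> :: real
  assumes \<eta>: "\<eta> > 0" and \<rho>: "\<rho> \<noteq> 0"
begin

text \<open>\<open>k\<close> is half of \<open>soliton_a \<eta>\<close>. With these normalisations
  \<open>W\<close> becomes \<open>12 * k\<close> times the Riccati function \<open>T\<close> of the
  phase.\<close>

definition k where "k = sqrt (\<eta> / 6)"
definition c where "c = 3 * C / (\<eta> * soliton_A \<eta> \<rho> C)"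
definition S where "S = \<rho> / (12 * k * soliton_A \<eta> \<rho> C)"

definition W :: "real \<times> real \<Rightarrow> complex" where
  "W p = Complex (soliton_w \<eta> \<rho> C \<beta> (fst p) (snd p)) (soliton_y \<eta> \<rho> C \<beta> (fst p) (snd p))"

definition T :: "real \<Rightarrow> complex" where
  "T \<theta> = Complex (sinh \<theta> / (cosh \<theta> - c)) (S / (cosh \<theta> - c))"

lemma k: "k > 0" "k\<^sup>2 = \<eta> / 6"
  using \<eta> by (simp_all add: k_def)

lemma A: "soliton_A \<eta> \<rho> C > 0"
proof -
  have "6 / \<eta> * (\<rho> / 12)\<^sup>2 > 0" using \<eta> \<rho> by simp
  then show ?thesis
    unfolding soliton_A_def by (intro real_sqrt_gt_zero add_nonneg_pos) auto
qed

lemma S: "S \<noteq> 0"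
  using \<rho> k A by (simp add: S_def)

text \<open>The two summands under the root in \<open>soliton_A\<close> are \<open>c\<^sup>2\<close>
  and \<open>S\<^sup>2\<close> times the square of \<open>soliton_A \<eta> \<rho> C\<close>.\<close>

lemma c_S: "c\<^sup>2 + S\<^sup>2 = 1"
proof -
  let ?A = "soliton_A \<eta> \<rho> C"
  have "6 / \<eta> * (\<rho> / 12)\<^sup>2 \<ge> 0" using \<eta> by simp
  then have A2: "?A\<^sup>2 = (3 * C / \<eta>)\<^sup>2 + 6 / \<eta> * (\<rho> / 12)\<^sup>2"
    by (simp add: soliton_A_def)
  have "c\<^sup>2 + S\<^sup>2 = ((3 * C / \<eta>)\<^sup>2 + (\<rho> / 12)\<^sup>2 / k\<^sup>2) / ?A\<^sup>2"
    by (simp add: c_def S_def power_divide power_mult_distrib add_divide_distrib)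
  also have "(\<rho> / 12)\<^sup>2 / k\<^sup>2 = 6 / \<eta> * (\<rho> / 12)\<^sup>2"
    by (simp add: k(2))
  finally show ?thesis using A unfolding A2[symmetric] by simp
qed

text \<open>The amplitude \<open>soliton_A\<close> cancels, so the proportionality hypothesis on the
  parameters becomes a condition on \<open>c\<close>, \<open>k\<close> and \<open>S\<close>.\<close>

lemma C_ratio: "C / (\<eta> * \<rho>) = c / (k * S) / 36"
  using \<eta> \<rho> k A by (simp add: c_def S_def)

lemma denom_pos: "cosh \<theta> - c > 0"
  by (rule cosh_minus_pos[OF c_S S])

lemma W_eq: "W p = 12 * k * T (soliton_phase \<eta> \<beta> (fst p) (snd p))"
proof -
  have "\<rho> / soliton_A \<eta> \<rho> C = 12 * k * S" using k A by (simp add: S_def)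
  then show ?thesis
    by (simp add: W_def T_def soliton_w_def soliton_y_def complex_eq_iff k_def[symmetric] c_def[symmetric])
qed

text \<open>Chain rule: the phase has partials \<open>2 * k\<close> and
  \<open>- (2 * k) ^ 3\<close>, whose ratio \<open>- 4 * k\<^sup>2\<close> is
  \<open>- (2 / 3) * \<eta>\<close>, while \<open>12 * k\<^sup>2 = 2 * \<eta>\<close> gives the
  constant term.\<close>

lemma W_partials:
  "has_partials W (\<lambda>p. 2 * \<eta> - (W p)\<^sup>2 / 12) (\<lambda>p. - (2 / 3) * (\<eta> * (2 * \<eta> - (W p)\<^sup>2 / 12)))"
  unfolding has_partials_def
proof
  fix p
  let ?\<theta> = "\<lambda>p. soliton_phase \<eta> \<beta> (fst p) (snd p)"
  let ?D = "(1 - (T (?\<theta> p))\<^sup>2) / 2"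
  have 1: "(?\<theta> has_derivative (\<lambda>d. 2 * k * fst d - (2 * k) ^ 3 * snd d)) (at p)"
    unfolding soliton_phase_def soliton_a_def k_def[symmetric]
    by (auto intro!: derivative_eq_intros)
  have 2: "(T has_derivative (\<lambda>h. h *\<^sub>R ?D)) (at (?\<theta> p))"
    using riccati_tanh_shifted[OF c_S S] unfolding T_def[abs_def] has_vector_derivative_def .
  have "(W has_derivative (\<lambda>d. 12 * k * ((2 * k * fst d - (2 * k) ^ 3 * snd d) *\<^sub>R ?D))) (at p)"
    using has_derivative_mult_right[OF has_derivative_compose[OF 1 2], of "12 * k"]
    by (simp only: W_eq[symmetric])
  moreover have "12 * k * ((2 * k * x - (2 * k) ^ 3 * t) *\<^sub>R ?D) =
      x *\<^sub>R (2 * \<eta> - (W p)\<^sup>2 / 12) + t *\<^sub>R (- (2 / 3) * (\<eta> * (2 * \<eta> - (W p)\<^sup>2 / 12)))" for x t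
  proof -
    \<comment> \<open>The identity is first proved for free complex variables, with
      \<open>6 * \<kappa>\<^sup>2\<close> in place of \<eta>, to keep coercions out of the
      algebra.\<close>
    have "12 * \<kappa> * ((2 * \<kappa> * x' - (2 * \<kappa>) ^ 3 * t') * ((1 - \<tau>\<^sup>2) / 2)) =
        x' * (2 * (6 * \<kappa>\<^sup>2) - (12 * \<kappa> * \<tau>)\<^sup>2 / 12)
        + t' * (- (2 / 3) * (6 * \<kappa>\<^sup>2 * (2 * (6 * \<kappa>\<^sup>2) - (12 * \<kappa> * \<tau>)\<^sup>2 / 12)))"
      for \<kappa> \<tau> x' t' :: complex
      by (simp add: power_mult_distrib) (simp add: algebra_simps power2_eq_square power3_eq_cube)
    from this[of k "of_real x" "of_real t" "T (?\<theta> p)"]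
    have "12 * k * ((2 * k * x - (2 * k) ^ 3 * t) *\<^sub>R ?D) =
        x *\<^sub>R (2 * (6 * k\<^sup>2) - (W p)\<^sup>2 / 12)
        + t *\<^sub>R (- (2 / 3) * (6 * k\<^sup>2 * (2 * (6 * k\<^sup>2) - (W p)\<^sup>2 / 12)))"
      unfolding W_eq scaleR_conv_of_real by simp
    moreover have "6 * k\<^sup>2 = \<eta>"
      using k(2) by simp
    ultimately show ?thesis by (simp only:)
  qed
  ultimately show "(W has_derivative (\<lambda>d. fst d *\<^sub>R (2 * \<eta> - (W p)\<^sup>2 / 12)
      + snd d *\<^sub>R (- (2 / 3) * (\<eta> * (2 * \<eta> - (W p)\<^sup>2 / 12))))) (at p)"
    by (simp only:)
qed

end

section \<open>Two solitons of equal ratio never meet\<close>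

lemma shifted_solitons_disjoint:
  fixes k1 k2 S1 S2 c1 c2 \<theta>1 \<theta>2 :: real
  defines "d1 \<equiv> cosh \<theta>1 - c1" and "d2 \<equiv> cosh \<theta>2 - c2"
  assumes k: "k1 > 0" "k2 > 0" "k1 \<noteq> k2"
    and S: "S1 \<noteq> 0" "S2 \<noteq> 0" and cS: "c1\<^sup>2 + S1\<^sup>2 = 1" "c2\<^sup>2 + S2\<^sup>2 = 1"
    and ratio: "c1 / (k1 * S1) = c2 / (k2 * S2)"
    and d: "d1 > 0" "d2 > 0"
    and w: "k1 * (sinh \<theta>1 / d1) = k2 * (sinh \<theta>2 / d2)"
    and y: "k1 * (S1 / d1) = k2 * (S2 / d2)"
  shows False
proof -
  define \<kappa> where "\<kappa> = c1 / (k1 * S1)"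
  define m where "m = sinh \<theta>1 / S1"
  define n where "n = cosh \<theta>1 / (k1 * S1)"
  \<comment> \<open>The reciprocal of the common imaginary part is \<open>n - \<kappa>\<close>; as
    \<kappa> is shared, so is \<open>n\<close>.\<close>
  have "d1 / (k1 * S1) = d2 / (k2 * S2)"
    using y k S d by (simp add: field_simps)
  then have n2: "n = cosh \<theta>2 / (k2 * S2)"
    using ratio by (simp add: n_def d1_def d2_def diff_divide_distrib)
  \<comment> \<open>\<open>m\<close> is the real part divided by the imaginary part, so it is shared
    too.\<close>
  have "m = (k1 * (sinh \<theta>1 / d1)) / (k1 * (S1 / d1))"
    using k d by (simp add: m_def)
  also have "\<dots> = sinh \<theta>2 / S2"
    unfolding w y using k d by simp
  finally have m2: "m = sinh \<theta>2 / S2" .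
  have key: "((C / (k * S))\<^sup>2 - (c / (k * S))\<^sup>2) * k\<^sup>2 = 1 + (s / S)\<^sup>2"
    if "k > 0" "S \<noteq> 0" "c\<^sup>2 + S\<^sup>2 = 1" "C\<^sup>2 = 1 + s\<^sup>2" for C k S c s :: real
  proof -
    have "((C / (k * S))\<^sup>2 - (c / (k * S))\<^sup>2) * k\<^sup>2 = (C\<^sup>2 - c\<^sup>2) / S\<^sup>2"
      using that(1) by (simp add: power_divide power_mult_distrib left_diff_distrib diff_divide_distrib)
    also have "C\<^sup>2 - c\<^sup>2 = S\<^sup>2 + s\<^sup>2" using that(3,4) by linarith
    finally show ?thesis using that(2) by (simp add: add_divide_distrib power_divide)
  qed
  have cosh: "(cosh \<theta>)\<^sup>2 = 1 + (sinh \<theta>)\<^sup>2" for \<theta> :: real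
    by (simp add: cosh_square_eq)
  have "(n\<^sup>2 - \<kappa>\<^sup>2) * k1\<^sup>2 = 1 + m\<^sup>2"
    unfolding n_def \<kappa>_def m_def by (rule key[OF k(1) S(1) cS(1) cosh])
  moreover have "(n\<^sup>2 - \<kappa>\<^sup>2) * k2\<^sup>2 = 1 + m\<^sup>2"
    unfolding n2 \<kappa>_def ratio m2 by (rule key[OF k(2) S(2) cS(2) cosh])
  ultimately have *: "(n\<^sup>2 - \<kappa>\<^sup>2) * k1\<^sup>2 = 1 + m\<^sup>2" "(n\<^sup>2 - \<kappa>\<^sup>2) * (k1\<^sup>2 - k2\<^sup>2) = 0"
    by (simp_all add: right_diff_distrib)
  have "k1\<^sup>2 \<noteq> k2\<^sup>2" using k by (auto simp: power2_eq_iff)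
  with *(2) have "n\<^sup>2 - \<kappa>\<^sup>2 = 0" by simp
  with *(1) have "1 + m\<^sup>2 = 0" by simp
  then show False using zero_le_power2[of m] by linarith
qed

section \<open>The system as a complex equation\<close>

lemma Dx_Re: "has_partials F X T \<Longrightarrow> Dx (\<lambda>x t. Re (F (x, t))) = (\<lambda>x t. Re (X (x, t)))"
  using has_partials_bounded_linear[OF bounded_linear_Re] by (intro Dx_has_partials) simp

lemma Dx_Im: "has_partials F X T \<Longrightarrow> Dx (\<lambda>x t. Im (F (x, t))) = (\<lambda>x t. Im (X (x, t)))"
  using has_partials_bounded_linear[OF bounded_linear_Im] by (intro Dx_has_partials) simp

lemma Dt_Re: "has_partials F X T \<Longrightarrow> Dt (\<lambda>x t. Re (F (x, t))) = (\<lambda>x t. Re (T (x, t)))"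
  using has_partials_bounded_linear[OF bounded_linear_Re] by (intro Dt_has_partials) simp

lemma Dt_Im: "has_partials F X T \<Longrightarrow> Dt (\<lambda>x t. Im (F (x, t))) = (\<lambda>x t. Im (T (x, t)))"
  using has_partials_bounded_linear[OF bounded_linear_Im] by (intro Dt_has_partials) simp

lemmas D_Re_Im = Dx_Re Dx_Im Dt_Re Dt_Im

text \<open>The square of \<open>Zx\<close> has real part the difference of the squares of its
  components and imaginary part twice their product; the minus sign is the choice \<lambda> = -1.
  Only x-partials enter beyond first order, so \<open>Zxt\<close> and \<open>Zxxt\<close> are
  arbitrary.\<close>

lemma potential_coupled_kdv_complex:
  assumes p: "has_partials Z Zx Zt" "has_partials Zx Zxx Zxt" "has_partials Zxx Zxxx Zxxt"
    and eq: "\<And>p. Zt p + (Zx p)\<^sup>2 / 2 + Zxxx p = 0"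
  shows "potential_coupled_kdv (\<lambda>x t. Re (Z (x, t))) (\<lambda>x t. Im (Z (x, t)))"
  unfolding potential_coupled_kdv_def D_Re_Im[OF p(1)] D_Re_Im[OF p(2)] D_Re_Im[OF p(3)]
proof (intro allI)
  fix x t
  show "Re (Zt (x, t)) + 1/2 * (Re (Zx (x, t)))\<^sup>2 + Re (Zxxx (x, t)) - 1/2 * (Im (Zx (x, t)))\<^sup>2 = 0 \<and>
        Im (Zt (x, t)) + Re (Zx (x, t)) * Im (Zx (x, t)) + Im (Zxxx (x, t)) = 0"
    using eq[of "(x, t)"] by (simp add: complex_eq_iff Re_power2 Im_power2 field_simps)
qed

lemma coupled_kdv_complex:
  assumes p: "has_partials U Ux Ut" "has_partials Ux Uxx Uxt" "has_partials Uxx Uxxx Uxxt"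
    and eq: "\<And>p. Ut p + U p * Ux p + Uxxx p = 0"
  shows "coupled_kdv (\<lambda>x t. Re (U (x, t))) (\<lambda>x t. Im (U (x, t)))"
  unfolding coupled_kdv_def D_Re_Im[OF p(1)] D_Re_Im[OF p(2)] D_Re_Im[OF p(3)]
proof (intro allI)
  fix x t
  show "Re (Ut (x, t)) + Re (U (x, t)) * Re (Ux (x, t)) + Re (Uxxx (x, t)) - Im (U (x, t)) * Im (Ux (x, t)) = 0 \<and>
        Im (Ut (x, t)) + Re (Ux (x, t)) * Im (U (x, t)) + Im (Ux (x, t)) * Re (U (x, t)) + Im (Uxxx (x, t)) = 0"
    using eq[of "(x, t)"] by (simp add: complex_eq_iff field_simps)
qed

section \<open>The permutability formula\<close>

text \<open>Here \<open>E1\<close>, \<open>E2\<close> stand for the x-derivatives of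
  \<open>W1\<close>, \<open>W2\<close>, the chain \<open>rx\<close>, \<open>rxx\<close>,
  \<open>rxxx\<close> for those of \<open>r\<close>, and \<open>r\<close>, \<open>q\<close> for
  \<open>Z\<^sub>x / Z\<close>, \<open>Z\<^sub>t / Z\<close>. The first two claims say that
  \<open>W1 - W2\<close> has logarithmic derivatives \<open>- r\<close> in x and \<open>- q\<close>
  in t; the third is the compatibility \<open>r\<^sub>t = q\<^sub>x\<close>.\<close>

lemma permutability_identities:
  fixes Z W1 W2 e1 e2 :: complex
  assumes ZW: "Z * (W1 - W2) = 24 * (e1 - e2)"
    and E: "E1 = 2 * e1 - W1\<^sup>2 / 12" "E2 = 2 * e2 - W2\<^sup>2 / 12"
    and r: "r = (W1 + W2 - Z) / 12"
    and rx: "rx = (E1 + E2 - Z * r) / 12"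
    and rxx: "rxx = (- (W1 * E1 + W2 * E2) / 6 - Z * (r\<^sup>2 + rx)) / 12"
    and rxxx: "rxxx = ((W1\<^sup>2 * E1 + W2\<^sup>2 * E2) / 36 - (E1\<^sup>2 + E2\<^sup>2) / 6
                        - Z * (r ^ 3 + 3 * r * rx + rxx)) / 12"
    and q: "q = - (Z * r\<^sup>2 / 2 + r ^ 3 + 3 * r * rx + rxx)"
  shows "E1 - E2 = - r * (W1 - W2)"
    and "2 / 3 * (e1 * E1 - e2 * E2) = q * (W1 - W2)"
    and "(- (2 / 3) * (e1 * E1 + e2 * E2) - Z * q) / 12 =
           - (Z * r ^ 3 / 2 + Z * r * rx + 3 * r\<^sup>2 * rx + 3 * rx\<^sup>2 + 3 * r * rxx + rxxx)"
proof -
  \<comment> \<open>\<open>r\<close>, \<open>rx\<close>, \<open>z\<close>, \<open>d\<close> parametrise all the data freely: expressed in them, the constraint \<open>ZW\<close>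
    holds identically, and the two remaining claims become plain polynomial identities.\<close>
  define z d where "z = Z / 2" and "d = (W1 - W2) / 2"
  \<comment> \<open>The factor 24 makes \<open>24 * (e1 - e2)\<close> appear literally, so that
    \<open>ZW\<close> replaces it and \<open>W1 - W2\<close> factors out.\<close>
  have "24 * (E1 - E2) = 2 * (24 * (e1 - e2)) - 2 * (W1\<^sup>2 - W2\<^sup>2)"
    by (simp add: E algebra_simps)
  also have "\<dots> = 24 * (- r * (W1 - W2))"
    unfolding ZW[symmetric] r by (simp add: field_simps power2_eq_square)
  finally have h: "24 * (E1 - E2) = 24 * (- r * (W1 - W2))" .
  show diff: "E1 - E2 = - r * (W1 - W2)"
    by (rule mult_left_cancel[THEN iffD1, OF _ h]) simp
  \<comment> \<open>The sum is read off from \<open>rx\<close> and the difference from the first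
    claim; together they determine \<open>E1\<close> and \<open>E2\<close>, and then
    \<open>e1\<close> and \<open>e2\<close>.\<close>
  have sum: "E1 + E2 = 12 * rx + Z * r" by (simp add: rx field_simps)
  have E': "E1 = 6 * rx + z * r - d * r" "E2 = 6 * rx + z * r + d * r"
    using sum diff by (simp_all add: z_def d_def field_simps) algebra+
  have W: "W1 = 6 * r + z + d" "W2 = 6 * r + z - d"
    by (simp_all add: z_def d_def r field_simps)
  have e: "e1 = (E1 + W1\<^sup>2 / 12) / 2" "e2 = (E2 + W2\<^sup>2 / 12) / 2"
    by (simp_all add: E)
  have Z: "Z = 2 * z" by (simp add: z_def)
  have rxx': "rxx = - ((6 * r + z) * (6 * rx + z * r) - d\<^sup>2 * r) / 36 - z * (r\<^sup>2 + rx) / 6"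
    unfolding rxx W E' Z by (simp add: field_simps power2_eq_square)
  show "2 / 3 * (e1 * E1 - e2 * E2) = q * (W1 - W2)"
    unfolding q rxx' e W E' Z
    by (simp add: field_simps power2_eq_square power3_eq_cube)
  show "(- (2 / 3) * (e1 * E1 + e2 * E2) - Z * q) / 12 =
           - (Z * r ^ 3 / 2 + Z * r * rx + 3 * r\<^sup>2 * rx + 3 * rx\<^sup>2 + 3 * r * rxx + rxxx)"
    unfolding rxxx q rxx' e W E' Z
    by (simp add: field_simps power2_eq_square power3_eq_cube)
qed

section \<open>The permuted function and its logarithmic derivatives\<close>

locale permuted_pair =
  fixes W1 W2 :: "real \<times> real \<Rightarrow> complex" and e1 e2 :: complex
  assumes W1: "has_partials W1 (\<lambda>p. 2 * e1 - (W1 p)\<^sup>2 / 12) (\<lambda>p. - (2 / 3) * (e1 * (2 * e1 - (W1 p)\<^sup>2 / 12)))"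
    and W2: "has_partials W2 (\<lambda>p. 2 * e2 - (W2 p)\<^sup>2 / 12) (\<lambda>p. - (2 / 3) * (e2 * (2 * e2 - (W2 p)\<^sup>2 / 12)))"
    and ne: "\<And>p. W1 p \<noteq> W2 p"
begin

text \<open>Inverting a complex number conjugates it and divides by the squared modulus; hence the
  denominator \<open>perm_denom\<close> and the minus sign in \<open>perm_y\<close>.\<close>

definition Z where "Z p = 24 * (e1 - e2) * inverse (W1 p - W2 p)"

abbreviation "E1 p \<equiv> 2 * e1 - (W1 p)\<^sup>2 / 12"
abbreviation "E2 p \<equiv> 2 * e2 - (W2 p)\<^sup>2 / 12"

text \<open>\<open>r\<close> and \<open>q\<close> are the logarithmic derivatives \<open>Z\<^sub>x / Z\<close> and \<open>Z\<^sub>t / Z\<close>; the equations for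
  \<open>Z\<close> and \<open>Z\<^sub>x\<close> reduce to the formula for \<open>q\<close> and to \<open>r\<^sub>t = q\<^sub>x\<close>.\<close>

definition r where "r p = (W1 p + W2 p - Z p) / 12"
definition rx where "rx p = (E1 p + E2 p - Z p * r p) / 12"
definition rxx where
  "rxx p = (- (W1 p * E1 p + W2 p * E2 p) / 6 - Z p * ((r p)\<^sup>2 + rx p)) / 12"
definition rxxx where
  "rxxx p = (((W1 p)\<^sup>2 * E1 p + (W2 p)\<^sup>2 * E2 p) / 36 - ((E1 p)\<^sup>2 + (E2 p)\<^sup>2) / 6
              - Z p * ((r p) ^ 3 + 3 * r p * rx p + rxx p)) / 12"
definition q where "q p = - (Z p * (r p)\<^sup>2 / 2 + (r p) ^ 3 + 3 * r p * rx p + rxx p)"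
definition qx where
  "qx p = - (Z p * (r p) ^ 3 / 2 + Z p * r p * rx p + 3 * (r p)\<^sup>2 * rx p + 3 * (rx p)\<^sup>2
              + 3 * r p * rxx p + rxxx p)"

lemma ZW: "Z p * (W1 p - W2 p) = 24 * (e1 - e2)"
  using ne[of p] by (simp add: Z_def)

lemmas identities = permutability_identities[OF ZW refl refl r_def rx_def rxx_def rxxx_def q_def]

lemma Z_partials: "has_partials Z (\<lambda>p. Z p * r p) (\<lambda>p. Z p * q p)"
proof -
  have ne': "W1 p - W2 p \<noteq> 0" for p using ne[of p] by simp
  note * = has_partials_cmult[OF has_partials_inverse[OF has_partials_diff[OF W1 W2] ne'],
      of "24 * (e1 - e2)", folded Z_def]
  show ?thesis
  proof (rule has_partials_cong[OF *])
    fix p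
    \<comment> \<open>If \<open>W1 - W2\<close> has logarithmic derivative \<open>- g\<close>, then
      its inverse, and so \<open>Z\<close>, has logarithmic derivative \<open>g\<close>. This serves
      both variables.\<close>
    have log_deriv: "24 * (e1 - e2) * - (inverse (W1 p - W2 p) * h * inverse (W1 p - W2 p)) = Z p * g"
      if "h = - g * (W1 p - W2 p)" for g h
      using ne'[of p] unfolding Z_def that by simp
    show "24 * (e1 - e2) * - (inverse (W1 p - W2 p) * (E1 p - E2 p) * inverse (W1 p - W2 p)) = Z p * r p"
      by (rule log_deriv[OF identities(1)])
    have "- (2 / 3) * a - - (2 / 3) * b = - (2 / 3 * (a - b))" for a b :: complex
      by (simp add: field_simps)
    then have "- (2 / 3) * (e1 * E1 p) - - (2 / 3) * (e2 * E2 p) = - q p * (W1 p - W2 p)"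
      unfolding mult_minus_left[of "q p"] identities(2)[symmetric] .
    then show "24 * (e1 - e2) * - (inverse (W1 p - W2 p) *
        (- (2 / 3) * (e1 * E1 p) - - (2 / 3) * (e2 * E2 p)) * inverse (W1 p - W2 p)) = Z p * q p"
      by (rule log_deriv)
  qed
qed

lemma r_partials: "has_partials r rx qx"
proof -
  note * = has_partials_cmult[OF has_partials_diff[OF has_partials_add[OF W1 W2] Z_partials], of "1 / 12"]
  have "has_partials (\<lambda>p. 1 / 12 * (W1 p + W2 p - Z p)) rx qx"
  proof (rule has_partials_cong[OF *])
    fix p
    show "1 / 12 * (E1 p + E2 p - Z p * r p) = rx p" by (simp add: rx_def)
    have "1 / 12 * (- (2 / 3) * a + - (2 / 3) * b - c) = (- (2 / 3) * (a + b) - c) / 12" for a b c :: complex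
      by (simp add: field_simps)
    then show "1 / 12 * (- (2 / 3) * (e1 * E1 p) + - (2 / 3) * (e2 * E2 p) - Z p * q p) = qx p"
      unfolding qx_def identities(3)[symmetric] .
  qed
  then show ?thesis by (simp add: r_def[abs_def])
qed

lemma W_square_partials:
  "has_partials (\<lambda>p. W1 p * W1 p) (\<lambda>p. 2 * W1 p * E1 p) (\<lambda>p. - (4 / 3) * e1 * W1 p * E1 p)"
  "has_partials (\<lambda>p. W2 p * W2 p) (\<lambda>p. 2 * W2 p * E2 p) (\<lambda>p. - (4 / 3) * e2 * W2 p * E2 p)"
  by (rule has_partials_cong[OF has_partials_mult[OF W1 W1]]; simp)
     (rule has_partials_cong[OF has_partials_mult[OF W2 W2]]; simp)

text \<open>Differentiating the Riccati equation gives
  \<open>W\<^sub>x\<^sub>x = - W W\<^sub>x / 6\<close>. From here on only x-partials are tracked for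
  the auxiliary functions, so the t-partial stays existential.\<close>

lemma E_partials:
  "\<exists>T. has_partials E1 (\<lambda>p. - (W1 p * E1 p) / 6) T"
  "\<exists>T. has_partials E2 (\<lambda>p. - (W2 p * E2 p) / 6) T"
proof -
  have "\<exists>T. has_partials (\<lambda>p. 2 * e1 - 1 / 12 * (W1 p * W1 p)) (\<lambda>p. - (W1 p * E1 p) / 6) T"
    by (rule exI, rule has_partials_cong[OF has_partials_diff[OF has_partials_const
          has_partials_cmult[OF W_square_partials(1)]] _ refl]) simp
  then show "\<exists>T. has_partials E1 (\<lambda>p. - (W1 p * E1 p) / 6) T" by (simp add: power2_eq_square)
  have "\<exists>T. has_partials (\<lambda>p. 2 * e2 - 1 / 12 * (W2 p * W2 p)) (\<lambda>p. - (W2 p * E2 p) / 6) T"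
    by (rule exI, rule has_partials_cong[OF has_partials_diff[OF has_partials_const
          has_partials_cmult[OF W_square_partials(2)]] _ refl]) simp
  then show "\<exists>T. has_partials E2 (\<lambda>p. - (W2 p * E2 p) / 6) T" by (simp add: power2_eq_square)
qed

lemma rx_partials: "\<exists>T. has_partials rx rxx T"
proof -
  obtain T U where T: "has_partials E1 (\<lambda>p. - (W1 p * E1 p) / 6) T"
    and U: "has_partials E2 (\<lambda>p. - (W2 p * E2 p) / 6) U"
    using E_partials by blast
  note * = has_partials_cmult[OF has_partials_diff[OF has_partials_add[OF T U]
      has_partials_mult[OF Z_partials r_partials]], of "1 / 12"]
  have "\<exists>T. has_partials (\<lambda>p. 1 / 12 * (E1 p + E2 p - Z p * r p)) rxx T"
    by (rule exI, rule has_partials_cong[OF * _ refl])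
       (simp add: rxx_def power2_eq_square algebra_simps add_divide_distrib diff_divide_distrib)
  then show ?thesis by (simp add: rx_def[abs_def])
qed

lemma rxx_partials: "\<exists>T. has_partials rxx rxxx T"
proof -
  obtain T U V where T: "has_partials E1 (\<lambda>p. - (W1 p * E1 p) / 6) T"
    and U: "has_partials E2 (\<lambda>p. - (W2 p * E2 p) / 6) U" and V: "has_partials rx rxx V"
    using E_partials rx_partials by blast
  note * = has_partials_cmult[OF has_partials_diff[OF
      has_partials_cmult[OF has_partials_add[OF has_partials_mult[OF W1 T] has_partials_mult[OF W2 U]], of "- 1 / 6"]
      has_partials_mult[OF Z_partials has_partials_add[OF has_partials_mult[OF r_partials r_partials] V]]], of "1 / 12"]
  have deriv: "1 / 12 * (- 1 / 6 * (E * E + A * (- (A * E) / 6) + (E' * E' + A' * (- (A' * E') / 6))) -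
        (z * s * (s * s + sx) + z * (sx * s + s * sx + sxx))) =
      ((A\<^sup>2 * E + A'\<^sup>2 * E') / 36 - (E\<^sup>2 + E'\<^sup>2) / 6 - z * (s ^ 3 + 3 * s * sx + sxx)) / 12"
    for A A' E E' z s sx sxx :: complex
    by (simp add: field_simps power2_eq_square power3_eq_cube)
  have "\<exists>T. has_partials (\<lambda>p. 1 / 12 * (- 1 / 6 * (W1 p * E1 p + W2 p * E2 p) - Z p * (r p * r p + rx p))) rxxx T"
    by (rule exI, rule has_partials_cong[OF * _ refl]) (unfold rxxx_def, rule deriv)
  moreover have "rxx = (\<lambda>p. 1 / 12 * (- 1 / 6 * (W1 p * E1 p + W2 p * E2 p) - Z p * (r p * r p + rx p)))"
  proof
    fix p
    have "(- a / 6 - b) / 12 = 1 / 12 * (- 1 / 6 * a - b)" for a b :: complex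
      by (simp add: field_simps)
    then show "rxx p = 1 / 12 * (- 1 / 6 * (W1 p * E1 p + W2 p * E2 p) - Z p * (r p * r p + rx p))"
      unfolding rxx_def power2_eq_square[of "r p"] .
  qed
  ultimately show ?thesis by simp
qed

lemma Zx_partials: "has_partials (\<lambda>p. Z p * r p) (\<lambda>p. Z p * ((r p)\<^sup>2 + rx p)) (\<lambda>p. Z p * (q p * r p + qx p))"
  by (rule has_partials_cong[OF has_partials_mult[OF Z_partials r_partials]])
     (simp_all add: algebra_simps power2_eq_square)

text \<open>Since \<open>Z\<^sub>x = Z r\<close>, each higher x-derivative is \<open>Z\<close> times
  a complete Bell polynomial in \<open>r\<close>, \<open>rx\<close>, \<open>rxx\<close> and so
  on.\<close>

lemma Zxx_partials:
  "\<exists>T. has_partials (\<lambda>p. Z p * ((r p)\<^sup>2 + rx p)) (\<lambda>p. Z p * ((r p) ^ 3 + 3 * r p * rx p + rxx p)) T"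
proof -
  obtain T where T: "has_partials rx rxx T" using rx_partials by blast
  note * = has_partials_mult[OF Z_partials has_partials_add[OF has_partials_mult[OF r_partials r_partials] T]]
  have "has_partials (\<lambda>p. Z p * (r p * r p + rx p)) (\<lambda>p. Z p * ((r p) ^ 3 + 3 * r p * rx p + rxx p))
      (\<lambda>p. Z p * q p * (r p * r p + rx p) + Z p * (qx p * r p + r p * qx p + T p))"
    by (rule has_partials_cong[OF *]) (simp_all add: algebra_simps power2_eq_square power3_eq_cube)
  then show ?thesis by (auto simp: power2_eq_square)
qed

lemma Zxxx_partials:
  "\<exists>T. has_partials (\<lambda>p. Z p * ((r p) ^ 3 + 3 * r p * rx p + rxx p))
     (\<lambda>p. Z p * ((r p) ^ 4 + 6 * (r p)\<^sup>2 * rx p + 3 * (rx p)\<^sup>2 + 4 * r p * rxx p + rxxx p)) T"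
proof -
  obtain T U where T: "has_partials rx rxx T" and U: "has_partials rxx rxxx U"
    using rx_partials rxx_partials by blast
  note * = has_partials_mult[OF Z_partials has_partials_add[OF has_partials_add[OF
      has_partials_mult[OF has_partials_mult[OF r_partials r_partials] r_partials]
      has_partials_mult[OF has_partials_cmult[OF r_partials, of 3] T]] U]]
  have "\<exists>T. has_partials (\<lambda>p. Z p * (r p * r p * r p + 3 * r p * rx p + rxx p))
     (\<lambda>p. Z p * ((r p) ^ 4 + 6 * (r p)\<^sup>2 * rx p + 3 * (rx p)\<^sup>2 + 4 * r p * rxx p + rxxx p)) T"
    by (rule exI, rule has_partials_cong[OF * _ refl])
       (simp add: algebra_simps power2_eq_square power3_eq_cube power4_eq_xxxx)
  then show ?thesis by (simp add: power3_eq_cube)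
qed

text \<open>After the common factor \<open>Z\<close> is taken out, the equation is the definition of
  \<open>q\<close>.\<close>

lemma potential: "potential_coupled_kdv (\<lambda>x t. Re (Z (x, t))) (\<lambda>x t. Im (Z (x, t)))"
proof -
  obtain T where T: "has_partials (\<lambda>p. Z p * ((r p)\<^sup>2 + rx p))
      (\<lambda>p. Z p * ((r p) ^ 3 + 3 * r p * rx p + rxx p)) T"
    using Zxx_partials by blast
  show ?thesis
    by (rule potential_coupled_kdv_complex[OF Z_partials Zx_partials T])
       (simp add: q_def field_simps power2_eq_square)
qed

text \<open>The same cancellation one x-derivative higher: the t-partial of \<open>Z * r\<close> is
  \<open>Z * (q * r + qx)\<close>, where \<open>r\<^sub>t = q\<^sub>x\<close> has been used.\<close>

lemma coupled: "coupled_kdv (Dx (\<lambda>x t. Re (Z (x, t)))) (Dx (\<lambda>x t. Im (Z (x, t))))"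
proof -
  obtain T where T: "has_partials (\<lambda>p. Z p * ((r p)\<^sup>2 + rx p))
      (\<lambda>p. Z p * ((r p) ^ 3 + 3 * r p * rx p + rxx p)) T"
    using Zxx_partials by blast
  obtain U where U: "has_partials (\<lambda>p. Z p * ((r p) ^ 3 + 3 * r p * rx p + rxx p))
     (\<lambda>p. Z p * ((r p) ^ 4 + 6 * (r p)\<^sup>2 * rx p + 3 * (rx p)\<^sup>2 + 4 * r p * rxx p + rxxx p)) U"
    using Zxxx_partials by blast
  show ?thesis
    unfolding D_Re_Im[OF Z_partials]
    by (rule coupled_kdv_complex[OF Zx_partials T U])
       (simp add: q_def qx_def field_simps power2_eq_square power3_eq_cube power4_eq_xxxx)
qed

section \<open>Smoothness of the permuted function\<close>

definition "gens = {W1, W2, \<lambda>p. inverse (W1 p - W2 p)}"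

lemma gen_algebra_gens:
  "W1 \<in> gen_algebra gens" "W2 \<in> gen_algebra gens"
  "(\<lambda>p. inverse (W1 p - W2 p)) \<in> gen_algebra gens"
  by (auto intro: gen_algebra.gen simp: gens_def)

lemmas gen_algebra_intros =
  gen_algebra_gens gen_algebra.const gen_algebra.add gen_algebra.mult gen_algebra_diff gen_algebra_minus

lemma gen_algebra_E:
  "E1 \<in> gen_algebra gens" "E2 \<in> gen_algebra gens"
proof -
  have "(\<lambda>p. 2 * e1 - 1 / 12 * (W1 p * W1 p)) \<in> gen_algebra gens"
    "(\<lambda>p. 2 * e2 - 1 / 12 * (W2 p * W2 p)) \<in> gen_algebra gens"
    by (intro gen_algebra_intros)+
  then show "E1 \<in> gen_algebra gens" "E2 \<in> gen_algebra gens"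
    by (simp_all add: power2_eq_square)
qed

text \<open>The Riccati right-hand sides are polynomials in \<open>W1\<close> and \<open>W2\<close>,
  and differentiating the inverse yields its own square times such polynomials.\<close>

lemma gens_closed:
  assumes "g \<in> gens"
  shows "\<exists>X\<in>gen_algebra gens. \<exists>T\<in>gen_algebra gens. has_partials g X T"
proof -
  have ne': "W1 p - W2 p \<noteq> 0" for p using ne[of p] by simp
  have I: "\<exists>X\<in>gen_algebra gens. \<exists>T\<in>gen_algebra gens. has_partials h X T"
    if "has_partials h X T" "X \<in> gen_algebra gens" "T \<in> gen_algebra gens" for h X T
    using that by blast
  consider "g = W1" | "g = W2" | "g = (\<lambda>p. inverse (W1 p - W2 p))"
    using assms by (auto simp: gens_def)
  then show ?thesis
  proof cases
    case 1
    show ?thesis unfolding 1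
      by (rule I[OF W1]; intro gen_algebra_E gen_algebra.mult[OF gen_algebra.const])
  next
    case 2
    show ?thesis unfolding 2
      by (rule I[OF W2]; intro gen_algebra_E gen_algebra.mult[OF gen_algebra.const])
  next
    case 3
    show ?thesis unfolding 3
      by (rule I[OF has_partials_inverse[OF has_partials_diff[OF W1 W2] ne']];
          intro gen_algebra_minus gen_algebra_diff gen_algebra_E gen_algebra_gens
            gen_algebra.mult[OF gen_algebra.mult] gen_algebra.mult[OF gen_algebra.const])
  qed
qed

lemma smooth:
  assumes "F \<in> gen_algebra gens"
  shows "smooth_field (\<lambda>x t. Re (F (x, t)))" "smooth_field (\<lambda>x t. Im (F (x, t)))"
  using Ck_on_UNIV_bounded_linear[OF bounded_linear_Re gen_algebra_Ck[OF gens_closed assms]]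
    Ck_on_UNIV_bounded_linear[OF bounded_linear_Im gen_algebra_Ck[OF gens_closed assms]]
  by (simp_all add: smooth_field_def split_beta')

lemma Z_gen_algebra: "Z \<in> gen_algebra gens" "(\<lambda>p. Z p * r p) \<in> gen_algebra gens"
proof -
  have "(\<lambda>p. Z p) \<in> gen_algebra gens"
    unfolding Z_def by (intro gen_algebra_intros)
  then show Z: "Z \<in> gen_algebra gens" by simp
  have "(\<lambda>p. Z p * (1 / 12 * (W1 p + W2 p - Z p))) \<in> gen_algebra gens"
    by (intro gen_algebra_intros Z)
  then show "(\<lambda>p. Z p * r p) \<in> gen_algebra gens" by (simp add: r_def)
qed

lemma regular_solution:
  defines "w \<equiv> \<lambda>x t. Re (Z (x, t))" and "y \<equiv> \<lambda>x t. Im (Z (x, t))"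
  shows "smooth_field w \<and> smooth_field y \<and> smooth_field (Dx w) \<and> smooth_field (Dx y) \<and>
         potential_coupled_kdv w y \<and> coupled_kdv (Dx w) (Dx y)"
  using potential coupled smooth[OF Z_gen_algebra(1)] smooth[OF Z_gen_algebra(2)]
  unfolding w_def y_def D_Re_Im[OF Z_partials] by blast

end

section \<open>Transfer to the real permutability formulas\<close>

theorem theorem5:
  fixes \<eta>1 \<rho>1 C1 \<beta>1 \<eta>2 \<rho>2 C2 \<beta>2 :: real
    and w1 y1 w2 y2 w12 y12 :: field2
  assumes "\<eta>1 > 0" and "\<rho>1 \<noteq> 0" and "\<eta>2 > 0" and "\<rho>2 \<noteq> 0"
    and "\<eta>1 \<noteq> \<eta>2"
    and "C1 / (\<eta>1 * \<rho>1) = C2 / (\<eta>2 * \<rho>2)"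
    and "w1 = soliton_w \<eta>1 \<rho>1 C1 \<beta>1" and "y1 = soliton_y \<eta>1 \<rho>1 C1 \<beta>1"
    and "w2 = soliton_w \<eta>2 \<rho>2 C2 \<beta>2" and "y2 = soliton_y \<eta>2 \<rho>2 C2 \<beta>2"
    and "w12 = perm_w \<eta>1 \<eta>2 w1 y1 w2 y2" and "y12 = perm_y \<eta>1 \<eta>2 w1 y1 w2 y2"
  shows "(\<forall>x t. perm_denom w1 y1 w2 y2 x t \<noteq> 0) \<and>
         smooth_field w12 \<and> smooth_field y12 \<and>
         smooth_field (Dx w12) \<and> smooth_field (Dx y12) \<and>
         potential_coupled_kdv w12 y12 \<and>
         coupled_kdv (Dx w12) (Dx y12)"
proof -
  interpret s1: soliton \<eta>1 \<rho>1 C1 \<beta>1 using assms by unfold_locales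
  interpret s2: soliton \<eta>2 \<rho>2 C2 \<beta>2 using assms by unfold_locales
  have W: "s1.W (x, t) = Complex (w1 x t) (y1 x t)" "s2.W (x, t) = Complex (w2 x t) (y2 x t)" for x t
    by (simp_all add: s1.W_def s2.W_def assms)
  have ne: "s1.W p \<noteq> s2.W p" for p
  proof
    assume "s1.W p = s2.W p"
    then have eq: "s1.k * s1.T (soliton_phase \<eta>1 \<beta>1 (fst p) (snd p)) =
        s2.k * s2.T (soliton_phase \<eta>2 \<beta>2 (fst p) (snd p))"
      unfolding s1.W_eq s2.W_eq by simp
    \<comment> \<open>Equal \<open>k\<close> would force equal \<eta>, because
      \<open>6 * k\<^sup>2 = \<eta>\<close>.\<close>
    have "s1.k \<noteq> s2.k" using s1.k(2) s2.k(2) assms(5) by auto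
    moreover have "s1.c / (s1.k * s1.S) = s2.c / (s2.k * s2.S)"
      using assms(6) unfolding s1.C_ratio s2.C_ratio by simp
    ultimately show False
      using eq by (intro shifted_solitons_disjoint[OF s1.k(1) s2.k(1) _ s1.S s2.S s1.c_S s2.c_S _
            s1.denom_pos[of "soliton_phase \<eta>1 \<beta>1 (fst p) (snd p)"]
            s2.denom_pos[of "soliton_phase \<eta>2 \<beta>2 (fst p) (snd p)"]])
         (simp_all add: s1.T_def s2.T_def complex_eq_iff)
  qed
  interpret permuted_pair s1.W s2.W \<eta>1 \<eta>2
    using s1.W_partials s2.W_partials ne by unfold_locales simp_all
  have Z: "Z (x, t) = 24 * (\<eta>1 - \<eta>2) / Complex (w1 x t - w2 x t) (y1 x t - y2 x t)" for x t
    by (simp add: Z_def W divide_inverse complex_diff)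
  have "w12 = (\<lambda>x t. Re (Z (x, t)))"
    by (intro ext) (simp add: Z assms(11) perm_w_def perm_denom_def Re_divide)
  moreover have "y12 = (\<lambda>x t. Im (Z (x, t)))"
    by (intro ext) (simp add: Z assms(12) perm_y_def perm_denom_def Im_divide left_diff_distrib right_diff_distrib diff_divide_distrib)
  \<comment> \<open>The denominator is the squared modulus of \<open>s1.W - s2.W\<close>.\<close>
  moreover have "perm_denom w1 y1 w2 y2 x t \<noteq> 0" for x t
    using ne[of "(x, t)"] by (simp add: perm_denom_def W sum_power2_eq_zero_iff)
  ultimately show ?thesis using regular_solution by blast
qed

end
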